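(* Let $\mathscr C$ be an $(\mathsf M,n)$ information retrieval (IR) scheme with queries $Q_1,\dots,Q_n$, where the leakage of the $l$-th server is defined as $I(M;Q_l)$, $l\in[n]$. Then there exists an $(\mathsf M,n)$ IR scheme $\overline{\mathscr C}$, with queries $\overline Q_1,\dots,\overline Q_n$, whose leakage at every server equals the average leakage of $\mathscr C$, i.e. $$I(M;\overline Q_l)=\bar\rho:=\frac1n\sum_{l'\in[n]} I(M;Q_{l'})\qquad\text{for every } l\in[n].$$
   Context: Notation: $[a]=\{1,\dots,a\}$; $I(\cdot;\cdot)$ is mutual information in bits. There are $n$ noncolluding servers, each storing the same $\mathsf M$ independent files $X^{(1)},\dots,X^{(\mathsf M)}$, each uniformly distributed on $\mathcal X^\beta$ for a finite alphabet $\mathcal X$. The requested file index $M$ is uniformly distributed on $[\mathsf M]$ and independent of the files. An $(\mathsf M,n)$ IR scheme consists of: a random strategy $S$ (a random variable with some alphabet $\mathcal S$, generated by the user independently of $M$ and of the files); $n$ query-encoding functions $\phi_l$ giving queries $Q_l=\phi_l(M,S)\in\mathcal Q_l$, where $Q_l$ is sent to server $l$; answer-length functions $\ell_l:\mathcal Q_l\to\{0,1,2,\dots\}$; answer functions $\varphi_l$ giving answers $A_l=\varphi_l(Q_l,X^{(1)},\dots,X^{(\mathsf M)})\in\mathcal A^{\ell_l(Q_l)}$ over a download alphabet $\mathcal A$; and access-number functions $\delta_l:\mathcal Q_l\to\{0,1,2,\dots\}$ (number of symbols accessed at server $l$). It must satisfy perfect retrievability: $H(X^{(M)}\mid A_1,\dots,A_n,Q_1,\dots,Q_n,M)=0$.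 *)

theory Defs
  imports "HOL-Probability.Probability"
begin

text \<open>
  Conventions. Servers and files are indexed from 1. The file alphabet is the finite type
  \<open>'x\<close>, the download alphabet is the countable type \<open>'a\<close>, and a word over an alphabet is a list.
  The query alphabets \<open>query_alph C l\<close> are arbitrary subsets of a countable type \<open>'q\<close>, so that
  mutual information and conditional entropy are the usual discrete ones. The random strategy is
  given by its law, a probability measure on an arbitrary measurable space.
\<close>

record ('s, 'q, 'x, 'a) ir_scheme =
  strategy :: "'s measure"
  query_alph :: "nat \<Rightarrow> 'q set"
  query :: "nat \<Rightarrow> nat \<Rightarrow> 's \<Rightarrow> 'q"
  ans_len :: "nat \<Rightarrow> 'q \<Rightarrow> nat"
  answer :: "nat \<Rightarrow> 'q \<Rightarrow> (nat \<Rightarrow> 'x list) \<Rightarrow> 'a list"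
  access :: "nat \<Rightarrow> 'q \<Rightarrow> nat"

definition words :: "nat \<Rightarrow> 'x::finite list set" where
  "words \<beta> = {w. length w = \<beta>}"

definition file_measure :: "nat \<Rightarrow> nat \<Rightarrow> (nat \<Rightarrow> 'x::finite list) measure" where
  "file_measure M \<beta> = (\<Pi>\<^sub>M m\<in>{1..M}. uniform_count_measure (words \<beta>))"

text \<open>
  The joint law of the requested index, the files and the strategy; independence of the three is
  expressed by the product measure.
\<close>

definition ir_space ::
  "nat \<Rightarrow> nat \<Rightarrow> ('s, 'q, 'x::finite, 'a) ir_scheme \<Rightarrow> (nat \<times> (nat \<Rightarrow> 'x list) \<times> 's) measure" where
  "ir_space M \<beta> C =
     uniform_count_measure {1..M} \<Otimes>\<^sub>M (file_measure M \<beta> \<Otimes>\<^sub>M strategy C)"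

definition index_rv :: "nat \<times> (nat \<Rightarrow> 'x list) \<times> 's \<Rightarrow> nat" where
  "index_rv = (\<lambda>(m, X, s). m)"

definition requested_file_rv :: "nat \<times> (nat \<Rightarrow> 'x list) \<times> 's \<Rightarrow> 'x list" where
  "requested_file_rv = (\<lambda>(m, X, s). X m)"

definition query_rv ::
  "('s, 'q, 'x, 'a) ir_scheme \<Rightarrow> nat \<Rightarrow> nat \<times> (nat \<Rightarrow> 'x list) \<times> 's \<Rightarrow> 'q" where
  "query_rv C l = (\<lambda>(m, X, s). query C l m s)"

definition answer_rv ::
  "('s, 'q, 'x, 'a) ir_scheme \<Rightarrow> nat \<Rightarrow> nat \<times> (nat \<Rightarrow> 'x list) \<times> 's \<Rightarrow> 'a list" where
  "answer_rv C l = (\<lambda>(m, X, s). answer C l (query C l m s) X)"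

definition user_view_rv ::
  "nat \<Rightarrow> ('s, 'q, 'x, 'a) ir_scheme \<Rightarrow> nat \<times> (nat \<Rightarrow> 'x list) \<times> 's
     \<Rightarrow> 'a list list \<times> 'q list \<times> nat" where
  "user_view_rv n C = (\<lambda>\<omega>. (map (\<lambda>l. answer_rv C l \<omega>) [1..<Suc n],
                             map (\<lambda>l. query_rv C l \<omega>) [1..<Suc n],
                             index_rv \<omega>))"

definition leakage ::
  "nat \<Rightarrow> nat \<Rightarrow> ('s, 'q::countable, 'x::finite, 'a) ir_scheme \<Rightarrow> nat \<Rightarrow> real" where
  "leakage M \<beta> C l =
     prob_space.mutual_information (ir_space M \<beta> C) 2
       (count_space UNIV) (count_space UNIV) index_rv (query_rv C l)"

definition retrievable ::
  "nat \<Rightarrow> nat \<Rightarrow> nat \<Rightarrow> ('s, 'q::countable, 'x::finite, 'a::countable) ir_scheme \<Rightarrow> bool" where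
  "retrievable M n \<beta> C \<longleftrightarrow>
     prob_space.conditional_entropy (ir_space M \<beta> C) 2
       (count_space UNIV) (count_space UNIV) requested_file_rv (user_view_rv n C) = 0"

text \<open>
  An IR scheme for \<open>M\<close> files of length \<open>\<beta>\<close> and \<open>n\<close> servers. The measurability condition says
  that \<open>query C l m\<close> is a random variable with values in \<open>query_alph C l\<close>. The access numbers
  carry no constraint.
\<close>

definition is_ir_scheme ::
  "nat \<Rightarrow> nat \<Rightarrow> nat \<Rightarrow> ('s, 'q::countable, 'x::finite, 'a::countable) ir_scheme \<Rightarrow> bool" where
  "is_ir_scheme M n \<beta> C \<longleftrightarrow>
     prob_space (strategy C) \<and>
     (\<forall>l\<in>{1..n}. \<forall>m\<in>{1..M}. query C l m \<in> strategy C \<rightarrow>\<^sub>M count_space (query_alph C l)) \<and>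
     (\<forall>l\<in>{1..n}. \<forall>q\<in>query_alph C l. \<forall>X\<in>{1..M} \<rightarrow>\<^sub>E words \<beta>.
        length (answer C l q X) = ans_len C l q) \<and>
     retrievable M n \<beta> C"

end

theory Submission
  imports Defs
begin

text \<open>
  Time sharing: the user draws a cyclic shift \<open>t\<close> of the servers uniformly at random, independently of
  everything else, runs the given scheme with the roles of the servers shifted by \<open>t\<close>, and includes
  \<open>t\<close> in every query. Since \<open>t\<close> is independent of the requested index, the leakage at server \<open>l\<close> is
  the mean over \<open>t\<close> of the leakage at the server whose role \<open>l\<close> plays, and these roles run once
  through all servers. Retrievability means that the requested file is almost surely a function of
  the answers, the queries and the index; since \<open>t\<close> can be read off the queries, the user can undo
  the shift and apply the same function.
\<close>

section \<open>Information measures on countable alphabets\<close>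

text \<open>Resolves the clash with the notation of \<^const>\<open>Infinite_Set_Sum.abs_summable_on\<close>.\<close>

no_notation Infinite_Sum.abs_summable_on (infixr "abs'_summable'_on" 46)

text \<open>Point masses as a real function on the whole type, so that they can serve as a density
  with respect to counting measure.\<close>

definition law :: "'w measure \<Rightarrow> ('w \<Rightarrow> 'b) \<Rightarrow> 'b \<Rightarrow> real" where
  "law P X x = measure P (X -` {x} \<inter> space P)"

text \<open>Dominates the summands of entropies and mutual informations by a multiple of a summable
  weight \<open>w\<close>. With \<open>f = p / w\<close>, the inequality
  \<open>ln x <= x - 1\<close>, applied to \<open>f\<close> when \<open>f >= 1\<close> and to
  \<open>1 / f\<close> otherwise, gives \<open>|f * ln f| <= 1 + f^2\<close>, and
  \<open>f <= K\<close>.\<close>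

lemma abs_mult_log_le:
  fixes p w K :: real
  assumes "0 \<le> p" "p \<le> K * w" "0 \<le> w"
  shows "\<bar>p * log 2 (p / w)\<bar> \<le> (1 + K\<^sup>2) / ln 2 * w"
\<comment> \<open>If \<open>w = 0\<close> then \<open>p = 0\<close> too, so the values of division
  and logarithm at 0 do not matter.\<close>
proof (cases "p = 0 \<or> w = 0")
  case True
  then show ?thesis using assms by auto
next
  case False
  define f where "f = p / w"
  have f: "0 < f" "f \<le> K" and p: "p = f * w"
    using False assms by (auto simp: f_def field_simps)
  have "\<bar>f * ln f\<bar> \<le> 1 + f\<^sup>2"
  proof (cases "f \<ge> 1")
    case True
    then have "0 \<le> ln f" "ln f \<le> f - 1" by (auto intro: ln_le_minus_one)
    then have "\<bar>f * ln f\<bar> \<le> f * f" using f by (auto simp: abs_mult intro!: mult_left_mono)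
    then show ?thesis by (simp add: power2_eq_square)
  next
    case False
    have "ln (1 / f) \<le> 1 / f - 1" using f by (intro ln_le_minus_one) auto
    then have "f * (- ln f) \<le> f * (1 / f - 1)"
      using f by (intro mult_left_mono) (auto simp: ln_div)
    also have "\<dots> \<le> 1 + f\<^sup>2" using f by (simp add: algebra_simps)
    finally show ?thesis using mult_pos_neg[of f "ln f"] f False by simp
  qed
  also have "\<dots> \<le> 1 + K\<^sup>2" using f by (auto intro!: power_mono)
  finally have "\<bar>f * ln f\<bar> * (w / ln 2) \<le> (1 + K\<^sup>2) * (w / ln 2)"
    using assms by (intro mult_right_mono) auto
  moreover have "\<bar>p * log 2 (p / w)\<bar> = \<bar>f * ln f\<bar> * (w / ln 2)"
    using assms by (simp add: p f_def[symmetric] log_def abs_mult)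
  ultimately show ?thesis by simp
qed

section \<open>Point masses of countably valued random variables\<close>

context prob_space
begin

lemma law_nonneg [simp]: "0 \<le> law M X x"
  by (simp add: law_def)

text \<open>On a countable type a measure is determined by its singletons. This opens the way to the
  library formulas for random variables with densities.\<close>

lemma distributed_law:
  fixes X :: "'a \<Rightarrow> 'b::countable"
  assumes [measurable]: "X \<in> M \<rightarrow>\<^sub>M count_space UNIV"
  shows "distributed M (count_space UNIV) X (law M X)"
  unfolding distributed_def
proof safe
  show "distr M (count_space UNIV) X = density (count_space UNIV) (\<lambda>x. ennreal (law M X x))"
  proof (rule measure_eqI_countable)
    fix x :: 'b
    show "emeasure (distr M (count_space UNIV) X) {x} =
      emeasure (density (count_space UNIV) (\<lambda>x. ennreal (law M X x))) {x}"
      by (subst emeasure_density)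
        (auto simp: emeasure_distr emeasure_eq_measure law_def nn_integral_indicator_singleton')
  qed auto
qed auto

text \<open>The constant 1 is integrable under the distribution of \<open>X\<close>; by the density
  formula this is summability of the masses.\<close>

lemma law_abs_summable:
  fixes X :: "'a \<Rightarrow> 'b::countable"
  assumes X: "X \<in> M \<rightarrow>\<^sub>M count_space UNIV"
  shows "law M X abs_summable_on UNIV"
proof -
  interpret X: prob_space "distr M (count_space UNIV) X" by (rule prob_space_distr) fact
  have "integrable (density (count_space UNIV) (\<lambda>x. ennreal (law M X x))) (\<lambda>_. 1 :: real)"
    using X.integrable_const[of 1]
    unfolding distributed_distr_eq_density[OF distributed_law[OF X]] .
  then show ?thesis
    by (subst (asm) integrable_real_density) (auto simp: abs_summable_on_def)
qed

lemma law_pair_le: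
  assumes [measurable]: "X \<in> M \<rightarrow>\<^sub>M count_space UNIV" "Y \<in> M \<rightarrow>\<^sub>M count_space UNIV"
  shows "law M (\<lambda>\<omega>. (X \<omega>, Y \<omega>)) (x, y) \<le> law M X x"
    and "law M (\<lambda>\<omega>. (X \<omega>, Y \<omega>)) (x, y) \<le> law M Y y"
  unfolding law_def by (auto intro!: finite_measure_mono)

lemma law_not_in_range: "x \<notin> X ` space M \<Longrightarrow> law M X x = 0"
proof -
  assume "x \<notin> X ` space M"
  then have "X -` {x} \<inter> space M = {}" by auto
  then show ?thesis by (simp only: law_def measure_empty)
qed

text \<open>A density does not charge the points where it vanishes.\<close>

lemma AE_law_ne_0:
  fixes X :: "'a \<Rightarrow> 'b::countable"
  assumes X[measurable]: "X \<in> M \<rightarrow>\<^sub>M count_space UNIV"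
  shows "AE \<omega> in M. law M X (X \<omega>) \<noteq> 0"
proof -
  have "AE x in density (count_space UNIV) (\<lambda>x. ennreal (law M X x)). law M X x \<noteq> 0"
    by (subst AE_density) auto
  then show ?thesis
    unfolding distributed_distr_eq_density[OF distributed_law[OF X], symmetric]
    by (subst (asm) AE_distr_iff) auto
qed

lemma measurable_pair_count_space:
  fixes X :: "'a \<Rightarrow> 'b::countable" and Y :: "'a \<Rightarrow> 'c::countable"
  assumes "X \<in> M \<rightarrow>\<^sub>M count_space UNIV" "Y \<in> M \<rightarrow>\<^sub>M count_space UNIV"
  shows "(\<lambda>\<omega>. (X \<omega>, Y \<omega>)) \<in> M \<rightarrow>\<^sub>M count_space UNIV"
  using measurable_Pair[OF assms] by (simp add: pair_measure_countable)

section \<open>Mutual information and conditional entropy as infinite sums\<close>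

lemma mutual_information_countable:
  fixes X :: "'a \<Rightarrow> 'b::countable" and Y :: "'a \<Rightarrow> 'c::countable"
  assumes X: "X \<in> M \<rightarrow>\<^sub>M count_space UNIV" and Y: "Y \<in> M \<rightarrow>\<^sub>M count_space UNIV"
  shows "mutual_information 2 (count_space UNIV) (count_space UNIV) X Y =
    (\<Sum>\<^sub>az\<in>UNIV. law M (\<lambda>\<omega>. (X \<omega>, Y \<omega>)) z *
        log 2 (law M (\<lambda>\<omega>. (X \<omega>, Y \<omega>)) z / (law M X (fst z) * law M Y (snd z))))"
proof -
  interpret information_space M 2 by standard simp
  show ?thesis
    using mutual_information_distr[of "count_space UNIV" "count_space UNIV" X "law M X" Y "law M Y"
        "law M (\<lambda>\<omega>. (X \<omega>, Y \<omega>))"]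
      distributed_law[OF X] distributed_law[OF Y]
      distributed_law[OF measurable_pair_count_space[OF X Y]]
    by (simp add: sigma_finite_measure_count_space infsetsum_def pair_measure_countable)
qed

lemma conditional_entropy_countable:
  fixes X :: "'a \<Rightarrow> 'b::countable" and Y :: "'a \<Rightarrow> 'c::countable"
  assumes X: "X \<in> M \<rightarrow>\<^sub>M count_space UNIV" and Y: "Y \<in> M \<rightarrow>\<^sub>M count_space UNIV"
  shows "conditional_entropy 2 (count_space UNIV) (count_space UNIV) X Y =
    - (\<Sum>\<^sub>az\<in>UNIV. law M (\<lambda>\<omega>. (X \<omega>, Y \<omega>)) z *
        log 2 (law M (\<lambda>\<omega>. (X \<omega>, Y \<omega>)) z / law M Y (snd z)))"
proof -
  interpret information_space M 2 by standard simp
  show ?thesis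
    using conditional_entropy_generic_eq[of "count_space UNIV" "count_space UNIV" Y "law M Y" X
        "law M (\<lambda>\<omega>. (X \<omega>, Y \<omega>))"]
      distributed_law[OF Y]
      distributed_law[OF measurable_pair_count_space[OF X Y]]
    by (simp add: sigma_finite_measure_count_space infsetsum_def pair_measure_countable case_prod_beta')
qed

text \<open>The dominating function consists of finitely many copies of the summable law of
  \<open>Y\<close>, one for each element of \<open>A\<close>.\<close>

lemma abs_summable_pair_bound:
  fixes Y :: "'a \<Rightarrow> 'c::countable" and f :: "'b::countable \<times> 'c \<Rightarrow> real"
  assumes Y: "Y \<in> M \<rightarrow>\<^sub>M count_space UNIV" and "finite A"
    and 0: "\<And>x y. x \<notin> A \<Longrightarrow> f (x, y) = 0"
    and le: "\<And>x y. x \<in> A \<Longrightarrow> \<bar>f (x, y)\<bar> \<le> c * law M Y y"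
  shows "f abs_summable_on UNIV"
proof -
  have "(\<lambda>(x, y). c * law M Y y) abs_summable_on A \<times> UNIV"
    using \<open>finite A\<close> law_abs_summable[OF Y]
    by (subst abs_summable_on_Sigma_iff) (auto simp: countable_finite)
  then have "f abs_summable_on A \<times> UNIV"
    using le by (rule_tac abs_summable_on_comparison_test') auto
  moreover have "f abs_summable_on A \<times> UNIV \<longleftrightarrow> f abs_summable_on UNIV"
    using 0 by (intro abs_summable_on_cong_neutral) auto
  ultimately show ?thesis by blast
qed

text \<open>
  The conditional entropy is a Bochner integral, which is also 0 for a non-integrable integrand;
  finiteness of the range of \<open>X\<close> excludes this case.
\<close>

lemma conditional_entropy_eq_0_iff:
  fixes X :: "'a \<Rightarrow> 'b::countable" and Y :: "'a \<Rightarrow> 'c::countable"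
  assumes X[measurable]: "X \<in> M \<rightarrow>\<^sub>M count_space UNIV" and Y[measurable]: "Y \<in> M \<rightarrow>\<^sub>M count_space UNIV"
    and fin: "finite (X ` space M)"
  shows "conditional_entropy 2 (count_space UNIV) (count_space UNIV) X Y = 0 \<longleftrightarrow>
    (\<exists>f. AE \<omega> in M. X \<omega> = f (Y \<omega>))"
proof -
  define p where "p = law M (\<lambda>\<omega>. (X \<omega>, Y \<omega>))"
  define h where "h = (\<lambda>z. - (p z * log 2 (p z / law M Y (snd z))))"
  note XY[measurable] = measurable_pair_count_space[OF X Y]
  have p_le: "p z \<le> law M Y (snd z)" for z
    using law_pair_le(2)[OF X Y, of "fst z" "snd z"] by (simp add: p_def)
  have p_nn: "0 \<le> p z" for z by (simp add: p_def)
  have summable: "h abs_summable_on UNIV"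
  proof (rule abs_summable_pair_bound[OF Y fin])
    fix x y
    show "h (x, y) = 0" if "x \<notin> X ` space M"
      using that by (auto simp: h_def p_def intro!: law_not_in_range)
    \<comment> \<open>Here \<open>K = 1\<close>, since a joint mass is at most the marginal
      mass.\<close>
    show "\<bar>h (x, y)\<bar> \<le> (1 + 1\<^sup>2) / ln 2 * law M Y y"
      using abs_mult_log_le[of "p (x, y)" 1 "law M Y y"] p_le[of "(x, y)"] p_nn
      by (simp add: h_def)
  qed
  have h_nn: "0 \<le> h z" for z
  proof (cases "p z = 0")
    case False
    then have "0 < p z / law M Y (snd z)" "p z / law M Y (snd z) \<le> 1"
      using p_nn[of z] p_le[of z] by (auto simp: field_simps)
    then show ?thesis unfolding h_def
      using p_nn[of z] by (auto simp: mult_le_0_iff)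
  qed (simp add: h_def)
  \<comment> \<open>A summand vanishes exactly if the joint mass is 0 or exhausts the mass of the
    second coordinate.\<close>
  have h_0: "h z = 0 \<longleftrightarrow> p z = 0 \<or> p z = law M Y (snd z)" for z
    using p_nn[of z] p_le[of z]
    by (cases "p z = 0") (auto simp: h_def log_def field_simps)
  have "conditional_entropy 2 (count_space UNIV) (count_space UNIV) X Y = infsetsum h UNIV"
    unfolding conditional_entropy_countable[OF X Y] by (simp add: h_def p_def infsetsum_uminus)
  also have "\<dots> = 0 \<longleftrightarrow> (\<forall>z. h z = 0)"
    using integral_nonneg_eq_0_iff_AE[of "count_space UNIV" h] summable h_nn
    by (simp add: infsetsum_def abs_summable_on_def AE_count_space)
  also have "\<dots> \<longleftrightarrow> (\<exists>f. AE \<omega> in M. X \<omega> = f (Y \<omega>))"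
  proof
    assume *: "\<forall>z. h z = 0"
    define f where "f y = (SOME x. p (x, y) \<noteq> 0)" for y
    \<comment> \<open>Two such values would each carry the full mass of \<open>y\<close>, on
      disjoint events, hence twice the mass of \<open>y\<close> in all.\<close>
    have uniq: "x = x'" if "p (x, y) \<noteq> 0" "p (x', y) \<noteq> 0" for x x' y
    proof (rule ccontr)
      assume "x \<noteq> x'"
      let ?E = "\<lambda>x. (\<lambda>\<omega>. (X \<omega>, Y \<omega>)) -` {(x, y)} \<inter> space M"
      have "p (x, y) + p (x', y) = prob (?E x \<union> ?E x')"
        unfolding p_def law_def using \<open>x \<noteq> x'\<close>
        by (intro finite_measure_Union[symmetric]) auto
      also have "\<dots> \<le> law M Y y"
        unfolding law_def by (intro finite_measure_mono) auto
      finally show False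
        using that h_0[of "(x, y)"] h_0[of "(x', y)"] * p_nn[of "(x, y)"] by auto
    qed
    have "AE \<omega> in M. p (X \<omega>, Y \<omega>) \<noteq> 0"
      using AE_law_ne_0[OF XY] by (simp add: p_def)
    then have "AE \<omega> in M. X \<omega> = f (Y \<omega>)"
    proof eventually_elim
      case (elim \<omega>)
      then show ?case unfolding f_def by (metis (mono_tags, lifting) someI uniq)
    qed
    then show "\<exists>f. AE \<omega> in M. X \<omega> = f (Y \<omega>)" by blast
  next
    assume "\<exists>f. AE \<omega> in M. X \<omega> = f (Y \<omega>)"
    then obtain f where f: "AE \<omega> in M. X \<omega> = f (Y \<omega>)" by blast
    \<comment> \<open>Up to null sets, given \<open>Y = y\<close> the value of \<open>X\<close> is
      \<open>f y\<close>: this \<open>x\<close> takes the whole mass and any other takes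
      none.\<close>
    have "p (x, y) = 0 \<or> p (x, y) = law M Y y" for x y
    proof (cases "x = f y")
      case True
      have "p (x, y) = law M Y y"
        unfolding p_def law_def
        using f True by (intro finite_measure_eq_AE) auto
      then show ?thesis by simp
    next
      case False
      have "p (x, y) = prob {}"
        unfolding p_def law_def
        using f False by (intro finite_measure_eq_AE) auto
      then show ?thesis by simp
    qed
    then show "\<forall>z. h z = 0" by (auto simp: h_0)
  qed
  finally show ?thesis .
qed

end

section \<open>The probability space of a scheme\<close>

lemma space_file_measure: "space (file_measure M \<beta>) = {1..M} \<rightarrow>\<^sub>E words \<beta>"
  by (simp add: file_measure_def space_PiM space_uniform_count_measure)

lemma finite_words [simp]: "finite (words \<beta> :: 'x::finite list set)"
  using finite_lists_length_eq[of "UNIV :: 'x set" \<beta>] by (simp add: words_def)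

lemma words_nonempty [simp]: "words \<beta> \<noteq> {}"
  by (auto simp: words_def intro: Ex_list_of_length)

lemma finite_files: "finite ({1..M::nat} \<rightarrow>\<^sub>E (words \<beta> :: 'x::finite list set))"
  by (intro finite_PiE) auto

text \<open>A finite product of finite discrete spaces is discrete, so files impose no measurability
  condition.\<close>

lemma sets_file_measure:
  "sets (file_measure M \<beta> :: (nat \<Rightarrow> 'x::finite list) measure) =
    sets (count_space ({1..M} \<rightarrow>\<^sub>E words \<beta>))"
proof -
  have "sets (file_measure M \<beta> :: (nat \<Rightarrow> 'x list) measure) =
      sets (\<Pi>\<^sub>M m\<in>{1..M}. count_space (words \<beta>))"
    unfolding file_measure_def
    by (intro sets_PiM_cong) (auto simp: sets_uniform_count_measure)
  then show ?thesis
    by (subst (asm) count_space_PiM_finite) (auto simp: countable_finite)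
qed

lemma prob_space_file_measure: "prob_space (file_measure M \<beta>)"
  unfolding file_measure_def
  by (intro prob_space_PiM prob_space_uniform_count_measure) auto

lemma measurable_map_count_space:
  fixes g :: "'l \<Rightarrow> 'w \<Rightarrow> 'b::countable"
  assumes "\<And>l. l \<in> set ls \<Longrightarrow> g l \<in> M \<rightarrow>\<^sub>M count_space UNIV"
  shows "(\<lambda>s. map (\<lambda>l. g l s) ls) \<in> M \<rightarrow>\<^sub>M count_space UNIV"
  using assms
proof (induction ls)
  case (Cons l ls)
  have "(\<lambda>s. (g l s, map (\<lambda>l. g l s) ls)) \<in> M \<rightarrow>\<^sub>M count_space UNIV \<Otimes>\<^sub>M count_space UNIV"
    using Cons by (intro measurable_Pair) auto
  then have "(\<lambda>(x, xs). x # xs) \<circ> (\<lambda>s. (g l s, map (\<lambda>l. g l s) ls)) \<in> M \<rightarrow>\<^sub>M count_space UNIV"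
    by (rule measurable_comp) (simp add: pair_measure_countable)
  then show ?case by (simp add: o_def)
qed simp

text \<open>Collects what makes the sample space and the queries well behaved. Answer lengths and
  retrievability are left out, so that the time-shared scheme can be an instance before these are
  proved for it.\<close>

locale query_scheme =
  fixes M n \<beta> :: nat and C :: "('s, 'q::countable, 'x::finite, 'a::countable) ir_scheme"
  assumes M_pos: "M \<ge> 1" and n_pos: "n \<ge> 1"
    and prob_strategy: "prob_space (strategy C)"
    and query_measurable: "l \<in> {1..n} \<Longrightarrow> m \<in> {1..M} \<Longrightarrow>
      query C l m \<in> strategy C \<rightarrow>\<^sub>M count_space (query_alph C l)"
begin

sublocale S: prob_space "strategy C" by (rule prob_strategy)

sublocale F: prob_space "file_measure M \<beta> :: (nat \<Rightarrow> 'x list) measure"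
  by (rule prob_space_file_measure)

sublocale U: prob_space "uniform_count_measure {1..M}"
  using M_pos by (intro prob_space_uniform_count_measure) auto

sublocale FS: pair_prob_space "file_measure M \<beta> :: (nat \<Rightarrow> 'x list) measure" "strategy C" ..

sublocale UFS: pair_prob_space "uniform_count_measure {1..M}" 
   "(file_measure M \<beta> :: (nat \<Rightarrow> 'x list) measure) \<Otimes>\<^sub>M strategy C" ..

sublocale P: prob_space "ir_space M \<beta> C"
  unfolding ir_space_def by (rule UFS.prob_space_axioms)

lemma space_ir_space:
  "space (ir_space M \<beta> C) = {1..M} \<times> ({1..M} \<rightarrow>\<^sub>E words \<beta>) \<times> space (strategy C)"
  by (simp add: ir_space_def space_pair_measure space_file_measure space_uniform_count_measure)

lemma sets_ir_space:
  "sets (ir_space M \<beta> C) =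
    sets (count_space {1..M} \<Otimes>\<^sub>M (count_space ({1..M} \<rightarrow>\<^sub>E words \<beta>) \<Otimes>\<^sub>M strategy C))"
  unfolding ir_space_def
  by (intro sets_pair_measure_cong) (auto simp: sets_file_measure sets_uniform_count_measure)

text \<open>Index and files range over finite discrete spaces, so measurability can be checked slice
  by slice in the strategy.\<close>

lemma measurable_ir_space:
  assumes "\<And>m X. m \<in> {1..M} \<Longrightarrow> X \<in> {1..M} \<rightarrow>\<^sub>E words \<beta> \<Longrightarrow>
    (\<lambda>s. f (m, X, s)) \<in> strategy C \<rightarrow>\<^sub>M K"
  shows "f \<in> ir_space M \<beta> C \<rightarrow>\<^sub>M K"
  unfolding measurable_cong_sets[OF sets_ir_space refl]
  by (intro measurable_pair_measure_countable1 countable_finite finite_files assms) auto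

lemma query_measurable_UNIV:
  "l \<in> {1..n} \<Longrightarrow> m \<in> {1..M} \<Longrightarrow> query C l m \<in> strategy C \<rightarrow>\<^sub>M count_space UNIV"
  by (rule measurable_compose[OF query_measurable, of _ _ "\<lambda>x. x", simplified]) auto

lemma index_rv_measurable: "index_rv \<in> ir_space M \<beta> C \<rightarrow>\<^sub>M count_space UNIV"
  by (rule measurable_ir_space) (simp add: index_rv_def)

lemma requested_file_rv_measurable:
  "requested_file_rv \<in> ir_space M \<beta> C \<rightarrow>\<^sub>M count_space UNIV"
  by (rule measurable_ir_space) (simp add: requested_file_rv_def)

lemma finite_range_requested_file_rv: "finite (requested_file_rv ` space (ir_space M \<beta> C))"
proof (rule finite_subset[OF _ finite_words])
  show "requested_file_rv ` space (ir_space M \<beta> C) \<subseteq> words \<beta>"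
    by (auto simp: space_ir_space requested_file_rv_def)
qed

lemma query_rv_measurable:
  "l \<in> {1..n} \<Longrightarrow> query_rv C l \<in> ir_space M \<beta> C \<rightarrow>\<^sub>M count_space UNIV"
  by (rule measurable_ir_space) (simp add: query_rv_def query_measurable_UNIV)

lemma user_view_rv_measurable:
  "user_view_rv n C \<in> ir_space M \<beta> C \<rightarrow>\<^sub>M count_space UNIV"
proof (rule measurable_ir_space)
  fix m and X :: "nat \<Rightarrow> 'x list"
  assume m: "m \<in> {1..M}"
  \<comment> \<open>For fixed index and files the whole view is a function of the list of queries,
    and every function on a discrete space is measurable.\<close>
  let ?dec = "\<lambda>qs. (map (\<lambda>(l, q). answer C l q X) (zip [1..<Suc n] qs), qs, m)"
  have "(\<lambda>s. map (\<lambda>l. query C l m s) [1..<Suc n]) \<in> strategy C \<rightarrow>\<^sub>M count_space UNIV"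
    using m by (intro measurable_map_count_space query_measurable_UNIV) auto
  then have "(\<lambda>s. ?dec (map (\<lambda>l. query C l m s) [1..<Suc n])) \<in> strategy C \<rightarrow>\<^sub>M count_space UNIV"
    by (rule measurable_compose) simp
  moreover have "?dec (map (\<lambda>l. query C l m s) [1..<Suc n]) = user_view_rv n C (m, X, s)" for s
    by (simp add: user_view_rv_def answer_rv_def query_rv_def index_rv_def zip_map2 zip_same_conv_map
        del: upt_Suc)
  ultimately show "(\<lambda>s. user_view_rv n C (m, X, s)) \<in> strategy C \<rightarrow>\<^sub>M count_space UNIV"
    by simp
qed

text \<open>Replaces an entropy by a decoder \<open>f\<close>, which can be composed with a map
  between the views of two schemes.\<close>

lemma retrievable_iff:
  "retrievable M n \<beta> C \<longleftrightarrow>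
    (\<exists>f. AE \<omega> in ir_space M \<beta> C. requested_file_rv \<omega> = f (user_view_rv n C \<omega>))"
  unfolding retrievable_def
  by (intro P.conditional_entropy_eq_0_iff requested_file_rv_measurable user_view_rv_measurable
      finite_range_requested_file_rv)

section \<open>Leakage as an absolutely convergent sum\<close>

lemma law_index:
  "law (ir_space M \<beta> C) index_rv m = (if m \<in> {1..M} then 1 / M else 0)"
proof -
  have "index_rv -` {m} \<inter> space (ir_space M \<beta> C) =
      ({m} \<inter> {1..M}) \<times> (space (file_measure M \<beta> \<Otimes>\<^sub>M strategy C))"
    by (auto simp: space_ir_space index_rv_def space_pair_measure space_file_measure)
  then have "law (ir_space M \<beta> C) index_rv m = measure (uniform_count_measure {1..M}) ({m} \<inter> {1..M})"
    unfolding law_def ir_space_def measure_def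
    by (simp add: FS.emeasure_pair_measure_Times sets_uniform_count_measure FS.emeasure_space_1)
  then show ?thesis
    by (auto simp: measure_uniform_count_measure)
qed

text \<open>The summand of the mutual information of index and query, named so that two schemes can
  be compared term by term.\<close>

definition leakage_term :: "nat \<Rightarrow> nat \<times> 'q \<Rightarrow> real" where
  "leakage_term l z =
    (let p = law (ir_space M \<beta> C) (\<lambda>\<omega>. (index_rv \<omega>, query_rv C l \<omega>)) z
     in p * log 2 (p / (law (ir_space M \<beta> C) index_rv (fst z) *
                        law (ir_space M \<beta> C) (query_rv C l) (snd z))))"

lemma leakage_eq: "l \<in> {1..n} \<Longrightarrow> leakage M \<beta> C l = infsetsum (leakage_term l) UNIV"
  unfolding leakage_def leakage_term_def Let_def
  by (intro P.mutual_information_countable index_rv_measurable query_rv_measurable)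

lemma leakage_term_summable:
  assumes l: "l \<in> {1..n}"
  shows "leakage_term l abs_summable_on UNIV"
proof (rule P.abs_summable_pair_bound[OF query_rv_measurable[OF l], of "{1..M}"])
  note meas = index_rv_measurable query_rv_measurable[OF l]
  fix m q
  let ?p = "law (ir_space M \<beta> C) (\<lambda>\<omega>. (index_rv \<omega>, query_rv C l \<omega>)) (m, q)"
  show "leakage_term l (m, q) = 0" if "m \<notin> {1..M}"
  proof -
    have "?p = 0"
      using P.law_pair_le(1)[OF meas, of m q] that by (intro antisym) (auto simp: law_index)
    then show ?thesis by (simp add: leakage_term_def)
  qed
  \<comment> \<open>The joint mass is at most the mass of the query, which is \<open>M\<close> times
    the product of the marginals \<open>1 / M\<close> and \<open>law\<close> of the query; hence
    \<open>K = M\<close>.\<close>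
  show "\<bar>leakage_term l (m, q)\<bar> \<le> (1 + M\<^sup>2) / ln 2 / M * law (ir_space M \<beta> C) (query_rv C l) q"
    if m: "m \<in> {1..M}"
    using abs_mult_log_le[of ?p M "1 / M * law (ir_space M \<beta> C) (query_rv C l) q"]
      P.law_pair_le(2)[OF meas, of m q] m
    by (simp add: leakage_term_def law_index Let_def)
qed simp

end

section \<open>Time sharing\<close>

text \<open>
  The server of the original scheme whose query goes to server \<open>l\<close> at time \<open>t\<close>. Servers are numbered
  from 1 and times from 0.
\<close>

definition server_at :: "nat \<Rightarrow> nat \<Rightarrow> nat \<Rightarrow> nat" where
  "server_at n t l = Suc ((l - 1 + t) mod n)"

lemma server_at_in: "n \<ge> 1 \<Longrightarrow> server_at n t l \<in> {1..n}"
  by (simp add: server_at_def Suc_leI)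

text \<open>Two times with the same role differ by a multiple of \<open>n\<close>, which is
  impossible for distinct times below \<open>n\<close>; equal cardinalities give
  surjectivity.\<close>

lemma bij_betw_server_at:
  assumes "n \<ge> 1"
  shows "bij_betw (\<lambda>t. server_at n t l) {..<n} {1..n}"
proof -
  have "inj_on (\<lambda>t. server_at n t l) {..<n}"
  proof (rule linorder_inj_onI)
    fix t t' assume "t < t'" "t' \<in> {..<n}"
    then show "server_at n t l \<noteq> server_at n t' l"
      using mod_eq_dvd_iff_nat[of "l - 1 + t" "l - 1 + t'" n]
      by (auto simp: server_at_def dest: dvd_imp_le)
  qed auto
  moreover have "(\<lambda>t. server_at n t l) ` {..<n} \<subseteq> {1..n}"
    using server_at_in[OF assms] by auto
  ultimately show ?thesis
    unfolding bij_betw_def by (intro conjI card_subset_eq) (auto simp: card_image)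
qed

text \<open>Server \<open>l\<close> sits at list position \<open>l - 1\<close>, and
  \<open>rotate t\<close> brings the entry at position \<open>(l - 1 + t) mod n\<close>
  there.\<close>

lemma map_server_at:
  "map (\<lambda>l. g (server_at n t l)) [1..<Suc n] = rotate t (map g [1..<Suc n])"
  by (rule nth_equalityI) (simp_all add: nth_rotate server_at_def add.commute del: upt_Suc)

text \<open>The time is a component of the strategy, so it inherits independence of the index and
  the files. Each server reads from its query which role to play.\<close>

definition time_shared ::
  "nat \<Rightarrow> ('s, 'q::countable, 'x::finite, 'a::countable) ir_scheme
    \<Rightarrow> ('s \<times> nat, 'q \<times> nat, 'x, 'a) ir_scheme" where
  "time_shared n C =
    \<lparr>strategy = strategy C \<Otimes>\<^sub>M uniform_count_measure {..<n},
     query_alph = (\<lambda>l. {(q, t). t < n \<and> q \<in> query_alph C (server_at n t l)}),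
     query = (\<lambda>l m (s, t). (query C (server_at n t l) m s, t)),
     ans_len = (\<lambda>l (q, t). ans_len C (server_at n t l) q),
     answer = (\<lambda>l (q, t). answer C (server_at n t l) q),
     access = (\<lambda>l (q, t). access C (server_at n t l) q)\<rparr>"

text \<open>Embeds the original sample space as the slice of time \<open>t\<close>;
  \<open>drop_time\<close> is a left inverse for every \<open>t\<close>.\<close>

definition at_time :: "nat \<Rightarrow> nat \<times> (nat \<Rightarrow> 'x list) \<times> 's \<Rightarrow> nat \<times> (nat \<Rightarrow> 'x list) \<times> 's \<times> nat" where
  "at_time t = (\<lambda>(m, X, s). (m, X, (s, t)))"

definition drop_time :: "nat \<times> (nat \<Rightarrow> 'x list) \<times> 's \<times> nat \<Rightarrow> nat \<times> (nat \<Rightarrow> 'x list) \<times> 's" where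
  "drop_time = (\<lambda>(m, X, (s, t)). (m, X, s))"

text \<open>All queries carry the same time, so the first one reveals it. Rotating by
  \<open>n - t\<close> after the rotation by \<open>t\<close> completes a full turn of lists of
  length \<open>n\<close>.\<close>

definition unrotate_view ::
  "nat \<Rightarrow> 'a list list \<times> ('q \<times> nat) list \<times> nat \<Rightarrow> 'a list list \<times> 'q list \<times> nat" where
  "unrotate_view n = (\<lambda>(as, qs, m).
     let t = snd (hd qs) in (rotate (n - t) as, rotate (n - t) (map fst qs), m))"

lemma unrotate_view_time_shared:
  assumes "n \<ge> 1" "t < n"
  shows "unrotate_view n (user_view_rv n (time_shared n C) (m, X, (s, t))) = user_view_rv n C (m, X, s)"
proof -
  have answers: "map (\<lambda>l. answer C (server_at n t l) (query C (server_at n t l) m s) X) [1..<Suc n] =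
      rotate t (map (\<lambda>l. answer C l (query C l m s) X) [1..<Suc n])"
    by (rule map_server_at)
  have queries: "map (\<lambda>l. query C (server_at n t l) m s) [1..<Suc n] =
      rotate t (map (\<lambda>l. query C l m s) [1..<Suc n])"
    by (rule map_server_at)
  have "[1..<Suc n] \<noteq> []" using assms by simp
  then show ?thesis
    using assms
    by (simp add: unrotate_view_def user_view_rv_def answer_rv_def query_rv_def index_rv_def
        time_shared_def hd_map o_def answers queries rotate_rotate Let_def
        del: upt_Suc One_nat_def)
qed

text \<open>Tonelli's theorem twice, with the strategy innermost, where the original and the
  time-shared space differ.\<close>

lemma nn_integral_triple:
  assumes "sigma_finite_measure B" "sigma_finite_measure D"
    and f: "f \<in> borel_measurable (A \<Otimes>\<^sub>M (B \<Otimes>\<^sub>M D))"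
  shows "(\<integral>\<^sup>+\<omega>. f \<omega> \<partial>(A \<Otimes>\<^sub>M (B \<Otimes>\<^sub>M D))) = (\<integral>\<^sup>+a. \<integral>\<^sup>+b. \<integral>\<^sup>+d. f (a, b, d) \<partial>D \<partial>B \<partial>A)"
proof -
  interpret D: sigma_finite_measure D by fact
  interpret BD: sigma_finite_measure "B \<Otimes>\<^sub>M D"
    by (intro sigma_finite_pair_measure assms)
  show ?thesis
    unfolding BD.nn_integral_fst[OF f, symmetric]
    by (intro nn_integral_cong D.nn_integral_fst[symmetric] measurable_compose[OF measurable_Pair1' f])
qed

section \<open>The sample space of the time-shared scheme as a mixture\<close>

context query_scheme
begin

sublocale T: prob_space "uniform_count_measure {..<n}"
  using n_pos by (intro prob_space_uniform_count_measure) (auto simp: lessThan_empty_iff bot_nat_def)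

sublocale ST: pair_prob_space "strategy C" "uniform_count_measure {..<n}" ..

lemma shifted_query_measurable:
  assumes "m \<in> {1..M}"
  shows "query (time_shared n C) l m \<in>
    strategy (time_shared n C) \<rightarrow>\<^sub>M count_space (query_alph (time_shared n C) l)"
proof -
  \<comment> \<open>The pair is swapped because the slice criterion wants the countable factor, here
    the time, in front.\<close>
  have "(\<lambda>(t, s). (query C (server_at n t l) m s, t)) \<in> count_space {..<n} \<Otimes>\<^sub>M strategy C \<rightarrow>\<^sub>M
      count_space (query_alph (time_shared n C) l)"
  proof (rule measurable_pair_measure_countable1)
    fix t assume "t \<in> {..<n}"
    then have "(\<lambda>q. (q, t)) \<in> count_space (query_alph C (server_at n t l)) \<rightarrow>\<^sub>M
        count_space (query_alph (time_shared n C) l)"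
      by (simp add: time_shared_def Pi_def)
    from measurable_compose[OF query_measurable[OF server_at_in[OF n_pos] assms] this]
    show "(\<lambda>s. case (t, s) of (t, s) \<Rightarrow> (query C (server_at n t l) m s, t)) \<in>
        strategy C \<rightarrow>\<^sub>M count_space (query_alph (time_shared n C) l)"
      by simp
  qed auto
  then have "(\<lambda>(s, t). (query C (server_at n t l) m s, t)) \<in> strategy C \<Otimes>\<^sub>M count_space {..<n} \<rightarrow>\<^sub>M
      count_space (query_alph (time_shared n C) l)"
    by (subst (asm) measurable_pair_swap_iff) (simp add: case_prod_beta')
  moreover have "sets (strategy (time_shared n C)) = sets (strategy C \<Otimes>\<^sub>M count_space {..<n})"
    by (auto simp: time_shared_def sets_uniform_count_measure intro!: sets_pair_measure_cong)
  ultimately show ?thesis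
    by (subst measurable_cong_sets[OF _ refl]) (auto simp: time_shared_def)
qed

lemma query_scheme_time_shared: "query_scheme M n (time_shared n C)"
  using M_pos n_pos ST.P.prob_space_axioms shifted_query_measurable
  by (intro query_scheme.intro) (auto simp: time_shared_def)

interpretation shared: query_scheme M n \<beta> "time_shared n C"
  by (rule query_scheme_time_shared)

lemma at_time_measurable [measurable]:
  assumes "t < n"
  shows "at_time t \<in> ir_space M \<beta> C \<rightarrow>\<^sub>M ir_space M \<beta> (time_shared n C)"
proof -
  have "t \<in> space (uniform_count_measure {..<n})"
    using assms by (simp add: space_uniform_count_measure)
  then show ?thesis
    unfolding ir_space_def at_time_def time_shared_def by simp
qed

lemma drop_time_measurable [measurable]:
  "drop_time \<in> ir_space M \<beta> (time_shared n C) \<rightarrow>\<^sub>M ir_space M \<beta> C"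
  unfolding ir_space_def drop_time_def time_shared_def by simp

text \<open>The new probability measure is the mixture, with weights \<open>1 / n\<close>, of the
  images of the old one under the embeddings \<open>at_time t\<close>. The time is integrated out
  first, which turns \<open>f\<close> into its average \<open>g\<close>.\<close>

lemma nn_integral_time_shared:
  assumes f: "f \<in> borel_measurable (ir_space M \<beta> (time_shared n C))"
  shows "(\<integral>\<^sup>+\<omega>. f \<omega> \<partial>ir_space M \<beta> (time_shared n C)) =
    (\<Sum>t<n. ennreal (1 / n) * (\<integral>\<^sup>+\<omega>. f (at_time t \<omega>) \<partial>ir_space M \<beta> C))"
proof -
  let ?U = "uniform_count_measure {1..M}"
  let ?F = "file_measure M \<beta> :: (nat \<Rightarrow> 'x list) measure"
  let ?S = "strategy C"
  let ?T = "uniform_count_measure {..<n}"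
  define g where "g = (\<lambda>\<omega>. \<Sum>t<n. ennreal (1 / n) * f (at_time t \<omega>))"
  have st: "strategy (time_shared n C) = ?S \<Otimes>\<^sub>M ?T" by (simp add: time_shared_def)
  have f': "f \<in> borel_measurable (?U \<Otimes>\<^sub>M (?F \<Otimes>\<^sub>M (?S \<Otimes>\<^sub>M ?T)))"
    using f by (simp add: ir_space_def st)
  have at[measurable]: "(\<lambda>\<omega>. f (at_time t \<omega>)) \<in> borel_measurable (ir_space M \<beta> C)" if "t < n" for t
    using measurable_compose[OF at_time_measurable[OF that] f] .
  have g: "g \<in> borel_measurable (ir_space M \<beta> C)"
    unfolding g_def by measurable
  have T: "(\<integral>\<^sup>+t. h t \<partial>?T) = (\<Sum>t<n. ennreal (1 / n) * h t)" for h
    unfolding uniform_count_measure_def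
    by (subst nn_integral_point_measure_finite) (auto simp: mult.commute)
  have "(\<integral>\<^sup>+\<omega>. f \<omega> \<partial>ir_space M \<beta> (time_shared n C)) =
      (\<integral>\<^sup>+m. \<integral>\<^sup>+X. \<integral>\<^sup>+z. f (m, X, z) \<partial>(?S \<Otimes>\<^sub>M ?T) \<partial>?F \<partial>?U)"
    unfolding ir_space_def st
    by (intro nn_integral_triple f' F.sigma_finite_measure_axioms ST.sigma_finite_measure_axioms)
  also have "\<dots> = (\<integral>\<^sup>+m. \<integral>\<^sup>+X. \<integral>\<^sup>+s. g (m, X, s) \<partial>?S \<partial>?F \<partial>?U)"
  proof (intro nn_integral_cong)
    fix m X assume "m \<in> space ?U" "X \<in> space ?F"
    then have "(\<lambda>z. f (m, X, z)) \<in> borel_measurable (?S \<Otimes>\<^sub>M ?T)"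
      by (intro measurable_compose[OF _ f'] measurable_Pair measurable_const measurable_ident_sets refl)
    then have "(\<integral>\<^sup>+z. f (m, X, z) \<partial>(?S \<Otimes>\<^sub>M ?T)) = (\<integral>\<^sup>+s. \<integral>\<^sup>+t. f (m, X, (s, t)) \<partial>?T \<partial>?S)"
      by (rule T.nn_integral_fst[symmetric])
    also have "\<dots> = (\<integral>\<^sup>+s. g (m, X, s) \<partial>?S)"
      by (simp add: T g_def at_time_def)
    finally show "(\<integral>\<^sup>+z. f (m, X, z) \<partial>(?S \<Otimes>\<^sub>M ?T)) = (\<integral>\<^sup>+s. g (m, X, s) \<partial>?S)" .
  qed
  also have "\<dots> = (\<integral>\<^sup>+\<omega>. g \<omega> \<partial>ir_space M \<beta> C)"
    using g unfolding ir_space_def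
    by (intro nn_integral_triple[symmetric] F.sigma_finite_measure_axioms S.sigma_finite_measure_axioms)
  also have "\<dots> = (\<Sum>t<n. ennreal (1 / n) * (\<integral>\<^sup>+\<omega>. f (at_time t \<omega>) \<partial>ir_space M \<beta> C))"
    unfolding g_def
    by (subst nn_integral_sum) (auto intro!: sum.cong nn_integral_cmult at)
  finally show ?thesis .
qed

text \<open>The mixture formula for the indicator of the event that \<open>Z\<close> equals
  \<open>z\<close>.\<close>

lemma law_time_shared:
  fixes Z :: "_ \<Rightarrow> 'b::countable"
  assumes Z: "Z \<in> ir_space M \<beta> (time_shared n C) \<rightarrow>\<^sub>M count_space UNIV"
  shows "law (ir_space M \<beta> (time_shared n C)) Z z =
    (\<Sum>t<n. law (ir_space M \<beta> C) (\<lambda>\<omega>. Z (at_time t \<omega>)) z / n)"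
proof -
  let ?P' = "ir_space M \<beta> (time_shared n C)"
  have at: "at_time t \<omega> \<in> space ?P'" if "\<omega> \<in> space (ir_space M \<beta> C)" "t < n" for t \<omega>
    using measurable_space[OF at_time_measurable] that by blast
  have "ennreal (law ?P' Z z) = (\<integral>\<^sup>+\<omega>. indicator (Z -` {z} \<inter> space ?P') \<omega> \<partial>?P')"
    using measurable_sets[OF Z, of "{z}"]
    by (simp add: law_def shared.P.emeasure_eq_measure)
  also have "\<dots> = (\<Sum>t<n. ennreal (1 / n) *
      (\<integral>\<^sup>+\<omega>. indicator (Z -` {z} \<inter> space ?P') (at_time t \<omega>) \<partial>ir_space M \<beta> C))"
    using measurable_sets[OF Z, of "{z}"] by (intro nn_integral_time_shared) simp
  also have "\<dots> = (\<Sum>t<n. ennreal (1 / n) * ennreal (law (ir_space M \<beta> C) (\<lambda>\<omega>. Z (at_time t \<omega>)) z))"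
  proof (intro sum.cong refl)
    fix t assume "t \<in> {..<n}"
    then have t: "t < n" by simp
    let ?A = "(\<lambda>\<omega>. Z (at_time t \<omega>)) -` {z} \<inter> space (ir_space M \<beta> C)"
    have "?A \<in> sets (ir_space M \<beta> C)"
      by (rule measurable_sets[OF measurable_compose[OF at_time_measurable[OF t] Z]]) simp
    moreover have "(\<integral>\<^sup>+\<omega>. indicator (Z -` {z} \<inter> space ?P') (at_time t \<omega>) \<partial>ir_space M \<beta> C) =
        (\<integral>\<^sup>+\<omega>. indicator ?A \<omega> \<partial>ir_space M \<beta> C)"
      by (intro nn_integral_cong) (auto simp: at[OF _ t] split: split_indicator)
    ultimately show "ennreal (1 / n) *
        (\<integral>\<^sup>+\<omega>. indicator (Z -` {z} \<inter> space ?P') (at_time t \<omega>) \<partial>ir_space M \<beta> C) =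
        ennreal (1 / n) * ennreal (law (ir_space M \<beta> C) (\<lambda>\<omega>. Z (at_time t \<omega>)) z)"
      by (simp add: law_def P.emeasure_eq_measure)
  qed
  also have "\<dots> = ennreal (\<Sum>t<n. law (ir_space M \<beta> C) (\<lambda>\<omega>. Z (at_time t \<omega>)) z / n)"
    by (subst sum_ennreal[symmetric]) (auto simp: ennreal_mult[symmetric])
  finally show ?thesis
    by (subst (asm) ennreal_inj) (auto intro!: sum_nonneg)
qed

text \<open>The preimage of a null set \<open>N\<close> under \<open>drop_time\<close> meets every
  time slice in a copy of \<open>N\<close>, so the mixture formula gives it mass 0.\<close>

lemma AE_drop_time:
  assumes "AE \<omega> in ir_space M \<beta> C. R \<omega>"
  shows "AE \<omega> in ir_space M \<beta> (time_shared n C). R (drop_time \<omega>)"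
proof -
  \<comment> \<open>The exceptional set of \<open>R\<close> may fail to be measurable, hence a
    measurable null superset.\<close>
  from assms obtain N where N: "{\<omega> \<in> space (ir_space M \<beta> C). \<not> R \<omega>} \<subseteq> N"
      "N \<in> null_sets (ir_space M \<beta> C)"
    by (auto elim!: eventually_ae_filter[THEN iffD1, elim_format])
  have [measurable]: "N \<in> sets (ir_space M \<beta> C)" using N by blast
  have "(\<integral>\<^sup>+\<omega>. indicator N (drop_time \<omega>) \<partial>ir_space M \<beta> (time_shared n C)) =
    (\<Sum>t<n. ennreal (1 / n) * (\<integral>\<^sup>+\<omega>. indicator N (drop_time (at_time t \<omega>)) \<partial>ir_space M \<beta> C))"
    by (rule nn_integral_time_shared) simp
  also have "\<dots> = 0"
    using N by (auto simp: drop_time_def at_time_def case_prod_beta')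
  finally have "AE \<omega> in ir_space M \<beta> (time_shared n C). indicator N (drop_time \<omega>) = (0 :: ennreal)"
    by (subst (asm) nn_integral_0_iff_AE) auto
  moreover have "AE \<omega> in ir_space M \<beta> (time_shared n C). drop_time \<omega> \<in> space (ir_space M \<beta> C)"
    using measurable_space[OF drop_time_measurable] by (intro AE_I2) blast
  ultimately show ?thesis
  proof eventually_elim
    case (elim \<omega>)
    then show ?case using N by (auto simp: indicator_def split: if_splits)
  qed
qed

text \<open>The new decoder applies the old one after \<open>unrotate_view\<close>; dropping the
  time does not change the requested file.\<close>

lemma retrievable_time_shared:
  assumes "retrievable M n \<beta> C"
  shows "retrievable M n \<beta> (time_shared n C)"
proof -
  obtain f where "AE \<omega> in ir_space M \<beta> C. requested_file_rv \<omega> = f (user_view_rv n C \<omega>)"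
    using assms retrievable_iff by blast
  from AE_drop_time[OF this] have "AE \<omega> in ir_space M \<beta> (time_shared n C).
      requested_file_rv \<omega> = f (unrotate_view n (user_view_rv n (time_shared n C) \<omega>))"
  proof (rule AE_mp, intro AE_I2 impI)
    fix \<omega> :: "nat \<times> (nat \<Rightarrow> 'x list) \<times> 's \<times> nat"
    assume \<omega>: "\<omega> \<in> space (ir_space M \<beta> (time_shared n C))"
      "requested_file_rv (drop_time \<omega>) = f (user_view_rv n C (drop_time \<omega>))"
    obtain m X s t where [simp]: "\<omega> = (m, X, s, t)" by (cases \<omega>) auto
    have "t < n"
      using \<omega> by (simp add: shared.space_ir_space)
        (simp add: time_shared_def space_pair_measure space_uniform_count_measure)
    then show "requested_file_rv \<omega> = f (unrotate_view n (user_view_rv n (time_shared n C) \<omega>))"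
      using \<omega>(2) unrotate_view_time_shared[OF n_pos, of t C m X s]
      by (simp add: drop_time_def requested_file_rv_def)
  qed
  then show ?thesis
    unfolding shared.retrievable_iff by (intro exI[of _ "\<lambda>v. f (unrotate_view n v)"])
qed

section \<open>Laws and leakage of the time-shared scheme\<close>

lemma law_pair_time_shared:
  assumes l: "l \<in> {1..n}"
  shows "law (ir_space M \<beta> (time_shared n C)) (\<lambda>\<omega>. (index_rv \<omega>, query_rv (time_shared n C) l \<omega>)) (m, q, t) =
    (if t < n then law (ir_space M \<beta> C) (\<lambda>\<omega>. (index_rv \<omega>, query_rv C (server_at n t l) \<omega>)) (m, q) / n else 0)"
proof -
  \<comment> \<open>The query displays its time, so only the slice \<open>u = t\<close> of the
    mixture meets the event.\<close>
  have "law (ir_space M \<beta> C) (\<lambda>\<omega>. (index_rv (at_time u \<omega>), query_rv (time_shared n C) l (at_time u \<omega>))) (m, q, t) =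
      (if u = t then law (ir_space M \<beta> C) (\<lambda>\<omega>. (index_rv \<omega>, query_rv C (server_at n t l) \<omega>)) (m, q) else 0)" for u
    by (cases "u = t")
      (simp_all add: law_def vimage_def index_rv_def query_rv_def at_time_def time_shared_def case_prod_beta)
  then show ?thesis
    by (subst law_time_shared)
      (simp_all add: shared.P.measurable_pair_count_space[OF shared.index_rv_measurable shared.query_rv_measurable[OF l]]
         if_distrib[of "\<lambda>x. x / _"] cong: if_cong)
qed

lemma law_query_time_shared:
  assumes l: "l \<in> {1..n}"
  shows "law (ir_space M \<beta> (time_shared n C)) (query_rv (time_shared n C) l) (q, t) =
    (if t < n then law (ir_space M \<beta> C) (query_rv C (server_at n t l)) q / n else 0)"
proof -
  have "law (ir_space M \<beta> C) (\<lambda>\<omega>. query_rv (time_shared n C) l (at_time u \<omega>)) (q, t) =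
      (if u = t then law (ir_space M \<beta> C) (query_rv C (server_at n t l)) q else 0)" for u
    by (cases "u = t")
      (simp_all add: law_def vimage_def query_rv_def at_time_def time_shared_def case_prod_beta)
  then show ?thesis
    by (subst law_time_shared)
      (simp_all add: shared.query_rv_measurable[OF l] if_distrib[of "\<lambda>x. x / _"] cong: if_cong)
qed

text \<open>The joint law and the law of the query both shrink by the factor \<open>1 / n\<close>
  while the law of the index stays the same, so the ratio inside the logarithm is unchanged. This is
  where independence of time and index enters.\<close>

lemma leakage_term_time_shared:
  assumes "l \<in> {1..n}"
  shows "shared.leakage_term l (m, q, t) =
    (if t < n then leakage_term (server_at n t l) (m, q) / n else 0)"
  using assms
  by (simp add: shared.leakage_term_def leakage_term_def Let_def law_pair_time_shared
      law_query_time_shared law_index shared.law_index)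

lemma leakage_time_shared:
  assumes l: "l \<in> {1..n}"
  shows "leakage M \<beta> (time_shared n C) l = (1 / n) * (\<Sum>l'\<in>{1..n}. leakage M \<beta> C l')"
proof -
  let ?f = "\<lambda>(t, m, q). shared.leakage_term l (m, q, t)"
  \<comment> \<open>Brings the time to the front, so that the sum can be split by time; absolute
    summability permits the regrouping.\<close>
  have bij: "bij_betw (\<lambda>(t, m, q). (m, q, t)) UNIV UNIV"
    by (intro bij_betwI[of _ _ _ "\<lambda>(m, q, t). (t, m, q)"]) auto
  have summable: "?f abs_summable_on UNIV"
    using shared.leakage_term_summable[OF l]
      abs_summable_on_reindex_bij_betw[OF bij, of "shared.leakage_term l"]
    by (simp add: case_prod_beta')
  have "leakage M \<beta> (time_shared n C) l = infsetsum ?f UNIV"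
    unfolding shared.leakage_eq[OF l]
      infsetsum_reindex_bij_betw[OF bij, of "shared.leakage_term l", symmetric]
    by (simp add: case_prod_beta')
  also have "\<dots> = infsetsum ?f ({..<n} \<times> UNIV)"
    by (intro infsetsum_cong_neutral) (auto simp: leakage_term_time_shared[OF l] split: if_splits)
  also have "\<dots> = (\<Sum>\<^sub>at\<in>{..<n}. \<Sum>\<^sub>az\<in>UNIV. ?f (t, z))"
    by (rule infsetsum_Times) (auto intro: abs_summable_on_subset[OF summable subset_UNIV])
  also have "\<dots> = (\<Sum>t<n. \<Sum>\<^sub>az\<in>UNIV. ?f (t, z))"
    by (rule infsetsum_finite) simp
  also have "\<dots> = (\<Sum>t<n. \<Sum>\<^sub>az\<in>UNIV. leakage_term (server_at n t l) z / n)"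
    by (intro sum.cong refl infsetsum_cong) (auto simp: leakage_term_time_shared[OF l])
  also have "\<dots> = (\<Sum>t<n. leakage M \<beta> C (server_at n t l) / n)"
    by (simp add: leakage_eq[OF server_at_in[OF n_pos]] infsetsum_cdiv
        leakage_term_summable[OF server_at_in[OF n_pos]])
  \<comment> \<open>Over the \<open>n\<close> times server \<open>l\<close> plays every role exactly
    once.\<close>
  also have "\<dots> = (\<Sum>l'\<in>{1..n}. leakage M \<beta> C l' / n)"
    by (rule sum.reindex_bij_betw[OF bij_betw_server_at[OF n_pos]])
  finally show ?thesis by (simp add: sum_divide_distrib)
qed

end

theorem theorem1:
  fixes C :: "('s, 'q::countable, 'x::finite, 'a::countable) ir_scheme"
    and M n \<beta> :: nat
  assumes "M \<ge> 1" and "n \<ge> 1"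
    and "is_ir_scheme M n \<beta> C"
  shows "\<exists>C' :: ('s \<times> nat, 'q \<times> nat, 'x, 'a) ir_scheme.
           is_ir_scheme M n \<beta> C' \<and>
           (\<forall>l\<in>{1..n}. leakage M \<beta> C' l = (1 / real n) * (\<Sum>l'\<in>{1..n}. leakage M \<beta> C l'))"
proof -
  interpret query_scheme M n \<beta> C
    using assms by (intro query_scheme.intro) (simp_all add: is_ir_scheme_def)
  interpret shared: query_scheme M n \<beta> "time_shared n C"
    by (rule query_scheme_time_shared)
  have "is_ir_scheme M n \<beta> (time_shared n C)"
    unfolding is_ir_scheme_def
  proof (intro conjI ballI)
    fix l q and X :: "nat \<Rightarrow> 'x list"
    assume q: "q \<in> query_alph (time_shared n C) l" and X: "X \<in> {1..M} \<rightarrow>\<^sub>E words \<beta>"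
    obtain q' t where [simp]: "q = (q', t)" by (cases q)
    have "q' \<in> query_alph C (server_at n t l)"
      using q by (simp add: time_shared_def)
    \<comment> \<open>The condition on \<open>C\<close> applies because the role played at time
      \<open>t\<close> is again a server in \<open>{1..n}\<close>.\<close>
    then have "length (answer C (server_at n t l) q' X) = ans_len C (server_at n t l) q'"
      using assms(3) server_at_in[OF n_pos] X unfolding is_ir_scheme_def by blast
    then show "length (answer (time_shared n C) l q X) = ans_len (time_shared n C) l q"
      by (simp add: time_shared_def)
  next
    have "retrievable M n \<beta> C" using assms(3) by (simp add: is_ir_scheme_def)
    then show "retrievable M n \<beta> (time_shared n C)" by (rule retrievable_time_shared)
  qed (fact shared.prob_strategy, rule shared.query_measurable)
  then show ?thesis
    using leakage_time_shared by blast
qed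

end
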